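(* For all integers $\Delta,t\geq 1$ and every $\varepsilon>0$, there is a finite connected graph $G$ with maximum degree $\Delta$ satisfying $$\textit{VR}(G,t)\geq 1-\frac{1}{\Delta}-\varepsilon.$$
   Context: The discrete Voronoi game on a finite graph $G$ with $t$ rounds: two players $\mathbf{A}$ and $\mathbf{B}$ alternately claim vertices of $G$, $\mathbf{A}$ first, each player claiming one vertex per round, for $t$ rounds (no vertex may be claimed twice). Distances are shortest-path distances in $G$. At the end, each vertex strictly closer to the set of $\mathbf{A}$'s claimed vertices than to the set of $\mathbf{B}$'s claimed vertices belongs to $\mathbf{A}$, each vertex strictly closer to $\mathbf{B}$'s set belongs to $\mathbf{B}$, and each vertex at equal distance is tied (each player receives half of it). The Voronoi ratio $\textit{VR}(G,t)$ is the number of vertices belonging to $\mathbf{A}$ plus half the number of tied vertices, divided by $|V(G)|$, when both players play optimally ($\mathbf{A}$ maximizing, $\mathbf{B}$ minimizing). *)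

theory Defs
  imports Complex_Main "Graph_Theory.Graph_Theory"
begin

text \<open>
  A finite simple undirected graph is a \<open>pair_graph\<close>: finite vertex set, symmetric loop-free
  set of arcs. The degree of a vertex is then its out-degree.
\<close>

definition max_degree :: "'a pair_pre_digraph \<Rightarrow> nat" where
  "max_degree G = Max (out_degree (with_proj G) ` pverts G)"

definition vdist :: "'a pair_pre_digraph \<Rightarrow> 'a \<Rightarrow> 'a \<Rightarrow> ereal" where
  "vdist G u v = wf_digraph.\<mu> (with_proj G) (\<lambda>_. 1) u v"

definition vsetdist :: "'a pair_pre_digraph \<Rightarrow> 'a \<Rightarrow> 'a set \<Rightarrow> ereal" where
  "vsetdist G v S = (INF s\<in>S. vdist G v s)"

definition voronoi_score :: "'a pair_pre_digraph \<Rightarrow> 'a set \<Rightarrow> 'a set \<Rightarrow> real" where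
  "voronoi_score G A B =
     real (card {v \<in> pverts G. vsetdist G v A < vsetdist G v B}) +
     real (card {v \<in> pverts G. vsetdist G v A = vsetdist G v B}) / 2"

text \<open>
  Minimax value of the position in which the players have claimed \<open>A\<close> and \<open>B\<close>.
  In \<open>value_A G k A B\<close> it is the first player's turn and \<open>k\<close> full rounds remain; in
  \<open>value_B G k A B\<close> it is the second player's turn and \<open>k\<close> full rounds remain after this move.
  If all vertices are claimed before the last round, the game ends at that point.
\<close>

fun value_A :: "'a pair_pre_digraph \<Rightarrow> nat \<Rightarrow> 'a set \<Rightarrow> 'a set \<Rightarrow> real"
  and value_B :: "'a pair_pre_digraph \<Rightarrow> nat \<Rightarrow> 'a set \<Rightarrow> 'a set \<Rightarrow> real" where
  "value_A G 0 A B = voronoi_score G A B"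
| "value_A G (Suc k) A B =
     (if pverts G - (A \<union> B) = {} then voronoi_score G A B
      else Max ((\<lambda>v. value_B G k (insert v A) B) ` (pverts G - (A \<union> B))))"
| "value_B G k A B =
     (if pverts G - (A \<union> B) = {} then voronoi_score G A B
      else Min ((\<lambda>v. value_A G k A (insert v B)) ` (pverts G - (A \<union> B))))"

definition voronoi_ratio :: "'a pair_pre_digraph \<Rightarrow> nat \<Rightarrow> real" where
  "voronoi_ratio G t = value_A G t {} {} / real (card (pverts G))"

end

theory Submission
  imports Defs "HOL-Library.Nat_Bijection"
begin

text \<open>
  For \<open>\<Delta> \<ge> 3\<close> the graph is a tree: a hub of degree \<open>\<Delta>\<close> from which \<open>\<Delta>\<close> rays start, where each ray
  carries \<open>m\<close> pendant paths, attached at exponentially growing distances from the hub. The pendant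
  paths are so long that they contain almost all vertices. The first player claims the hub and then
  answers every claim of the second player on a ray by claiming a nearby vertex of the ray further
  away from the hub. An answered claim \<open>b\<close> is cut off from the outer part of its ray, while pendant
  paths attached at less than half its distance are closer to the hub; since the distances grow
  exponentially, \<open>b\<close> wins at most one pendant path. Only the last claim stays unanswered, and it wins at
  most its ray, a fraction \<open>1 / \<Delta>\<close> of the graph.

  For \<open>\<Delta> = 2\<close> and \<open>t \<ge> 2\<close> a path with \<open>2 * t\<close> vertices suffices, because all its vertices are claimed.
\<close>

section \<open>Distances\<close>

text \<open>Increments of the potential telescope along a walk, so no walk can be cheaper than the
  total increment. Lower bounds on distances all come from such potentials.\<close>

lemma (in pair_wf_digraph) potential_le_vdist:
  fixes \<phi> :: "'a \<Rightarrow> real"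
  assumes "\<And>u v. (u, v) \<in> parcs G \<Longrightarrow> \<phi> v \<le> \<phi> u + 1"
  shows "ereal (\<phi> v - \<phi> u) \<le> vdist G u v"
proof -
  have "\<phi> v \<le> \<phi> u + awalk_cost (\<lambda>_. 1) p" if "awalk u p v" for u p
    using that
  proof (induction p arbitrary: u)
    case Nil
    then show ?case by (simp add: awalk_Nil_iff)
  next
    case (Cons e p)
    then have "e \<in> parcs G" "fst e = u" "awalk (snd e) p v"
      by (auto simp: awalk_Cons_iff)
    with Cons.IH[of "snd e"] assms[of u "snd e"] show ?case
      by (cases e) auto
  qed
  then show ?thesis
    unfolding vdist_def \<mu>_def by (intro INF_greatest) (auto simp: algebra_simps)
qed

lemma (in pair_wf_digraph) vdist_self_le:
  assumes "v \<in> pverts G"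
  shows "vdist G v v \<le> 0"
  using min_cost_le_walk_cost[of v "[]" v "\<lambda>_. 1"] assms
  by (simp add: vdist_def awalk_Nil_iff zero_ereal_def)

lemma (in pair_wf_digraph) vdist_arc_le:
  assumes "(u, v) \<in> parcs G" "vdist G v w \<le> ereal d"
  shows "vdist G u w \<le> ereal (1 + d)"
\<comment> \<open>The infimum defining the distance is not known to be attained, so a walk within
  \<open>e\<close> of it is prolonged by the arc.\<close>
proof (rule ereal_le_epsilon2)
  fix e :: real
  assume "0 < e"
  with assms(2) have "vdist G v w < ereal (d + e)"
    by (simp add: order_le_less_trans)
  then obtain p where p: "awalk v p w" "awalk_cost (\<lambda>_. 1) p < d + e"
    unfolding vdist_def \<mu>_def by (auto simp: INF_less_iff)
  have "awalk u ((u, v) # p) w"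
    using p assms(1) by (simp add: awalk_Cons_iff)
  from min_cost_le_walk_cost[OF this, of "\<lambda>_. 1"]
  have "vdist G u w \<le> ereal (1 + awalk_cost (\<lambda>_. 1) p)"
    by (simp add: vdist_def)
  also have "\<dots> \<le> ereal (1 + d + e)"
    using p by simp
  finally show "vdist G u w \<le> ereal (1 + d) + ereal e"
    by simp
qed

text \<open>The gap of 1 between \<open>d\<close> and the potential bound survives the infimum over
  \<open>B\<close>; this keeps the comparison strict, also for empty \<open>B\<close>.\<close>

lemma (in pair_wf_digraph) vsetdist_less:
  fixes \<phi> :: "'a \<Rightarrow> real"
  assumes "a \<in> A" "vdist G v a \<le> ereal d"
    and "\<And>u w. (u, w) \<in> parcs G \<Longrightarrow> \<phi> w \<le> \<phi> u + 1"
    and "\<And>b. b \<in> B \<Longrightarrow> \<phi> v + d + 1 \<le> \<phi> b"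
  shows "vsetdist G v A < vsetdist G v B"
proof -
  have "vsetdist G v A \<le> ereal d"
    unfolding vsetdist_def using assms(1,2) by (rule INF_lower2)
  also have "ereal d < ereal (d + 1)"
    by simp
  also have "ereal (d + 1) \<le> vsetdist G v B"
    unfolding vsetdist_def
  proof (rule INF_greatest)
    fix b
    assume "b \<in> B"
    then have "ereal (d + 1) \<le> ereal (\<phi> b - \<phi> v)"
      using assms(4) by fastforce
    also have "\<dots> \<le> vdist G v b"
      using assms(3) by (rule potential_le_vdist)
    finally show "ereal (d + 1) \<le> vdist G v b" .
  qed
  finally show ?thesis .
qed

lemma (in pair_wf_digraph) vsetdist_claimed_less:
  assumes "a \<in> A" "a \<in> pverts G" "A \<inter> B = {}"
  shows "vsetdist G a A < vsetdist G a B"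
proof (rule vsetdist_less)
  show "vdist G a a \<le> ereal 0"
    using vdist_self_le[OF assms(2)] by (simp add: zero_ereal_def)
  \<comment> \<open>The potential is the indicator of the vertices other than
    \<open>a\<close>.\<close>
  show "of_bool (a \<noteq> a) + 0 + 1 \<le> (of_bool (a \<noteq> b) :: real)" if "b \<in> B" for b
    using that assms by auto
qed (use assms in auto)

lemma voronoi_score_ge_card:
  assumes "finite (pverts G)" "S \<subseteq> pverts G"
    and "\<And>v. v \<in> S \<Longrightarrow> vsetdist G v A < vsetdist G v B"
  shows "real (card S) \<le> voronoi_score G A B"
proof -
  have "card S \<le> card {v \<in> pverts G. vsetdist G v A < vsetdist G v B}"
    using assms by (intro card_mono) auto
  then show ?thesis
    unfolding voronoi_score_def by (simp add: add_increasing2)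
qed

section \<open>Strategies of the first player\<close>

lemma value_B_le_value_A:
  assumes "finite (pverts G)" "v \<in> pverts G - (A \<union> B)"
  shows "value_B G k (insert v A) B \<le> value_A G (Suc k) A B"
  using assms by (auto simp del: value_B.simps intro!: Max_ge)

lemma value_B_ge:
  assumes "finite (pverts G)"
    and "pverts G \<subseteq> A \<union> B \<Longrightarrow> s \<le> voronoi_score G A B"
    and "\<And>v. v \<in> pverts G - (A \<union> B) \<Longrightarrow> s \<le> value_A G k A (insert v B)"
  shows "s \<le> value_B G k A B"
  using assms by (auto simp: Min_ge_iff)

text \<open>\<open>I\<close> describes positions with the first player to move, \<open>J\<close>
  those with the second player to move. One good move from \<open>I\<close> to \<open>J\<close>
  suffices, whereas every claim from \<open>J\<close> must lead back to \<open>I\<close>; this is a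
  strategy guaranteeing \<open>s\<close>. The game may also stop at a full board, on either player's
  turn.\<close>

lemma value_ge_invariant:
  assumes fin: "finite (pverts G)"
    and final: "\<And>k A B. I k A B \<Longrightarrow> k = 0 \<or> pverts G \<subseteq> A \<union> B \<Longrightarrow> s \<le> voronoi_score G A B"
    and full: "\<And>k A B. J k A B \<Longrightarrow> pverts G \<subseteq> A \<union> B \<Longrightarrow> s \<le> voronoi_score G A B"
    and move: "\<And>k A B. I (Suc k) A B \<Longrightarrow> \<not> pverts G \<subseteq> A \<union> B \<Longrightarrow>
                 \<exists>v \<in> pverts G - (A \<union> B). J k (insert v A) B"
    and reply: "\<And>k A B v. J k A B \<Longrightarrow> v \<in> pverts G - (A \<union> B) \<Longrightarrow> I k A (insert v B)"
  shows "I k A B \<Longrightarrow> s \<le> value_A G k A B"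
    and "J k A B \<Longrightarrow> s \<le> value_B G k A B"
proof -
  have B: "s \<le> value_B G k A B" if "\<And>A B. I k A B \<Longrightarrow> s \<le> value_A G k A B" "J k A B" for k A B
    using value_B_ge[OF fin, of A B s k] that full reply by blast
  have A: "s \<le> value_A G k A B" if "I k A B" for k A B
    using that
  proof (induction k arbitrary: A B)
    case 0
    then show ?case using final by simp
  next
    case (Suc k)
    show ?case
    proof (cases "pverts G \<subseteq> A \<union> B")
      case True
      then show ?thesis using final[OF Suc.prems] by auto
    next
      case False
      then obtain v where v: "v \<in> pverts G - (A \<union> B)" "J k (insert v A) B"
        using move[OF Suc.prems] by blast
      have "s \<le> value_B G k (insert v A) B"
        using Suc.IH v(2) by (rule B)
      also have "\<dots> \<le> value_A G (Suc k) A B"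
        using fin v(1) by (rule value_B_le_value_A)
      finally show ?thesis .
    qed
  qed
  show "I k A B \<Longrightarrow> s \<le> value_A G k A B" by (rule A)
  show "J k A B \<Longrightarrow> s \<le> value_B G k A B" using A by (rule B)
qed

lemma value_A_nonneg:
  assumes "finite (pverts G)"
  shows "0 \<le> value_A G k A B"
  by (rule value_ge_invariant(1)[where I = "\<lambda>_ _ _. True" and J = "\<lambda>_ _ _. True"])
    (use assms in \<open>auto simp: voronoi_score_def\<close>)

section \<open>Rooted trees\<close>

definition parent_graph :: "'a set \<Rightarrow> 'a \<Rightarrow> ('a \<Rightarrow> 'a) \<Rightarrow> 'a pair_pre_digraph" where
  "parent_graph V r p =
     \<lparr>pverts = V, parcs = (\<lambda>u. (u, p u)) ` (V - {r}) \<union> (\<lambda>u. (p u, u)) ` (V - {r})\<rparr>"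

lemma pverts_parent_graph [simp]: "pverts (parent_graph V r p) = V"
  by (simp add: parent_graph_def)

lemma parcs_parent_graph:
  "(u, v) \<in> parcs (parent_graph V r p) \<longleftrightarrow>
     u \<in> V \<and> u \<noteq> r \<and> v = p u \<or> v \<in> V \<and> v \<noteq> r \<and> u = p v"
  by (auto simp: parent_graph_def)

text \<open>The decreasing \<open>rank\<close> excludes loops and lets an induction reach the root
  from every vertex.\<close>

locale rooted_tree =
  fixes V :: "'a set" and r :: 'a and p :: "'a \<Rightarrow> 'a" and rank :: "'a \<Rightarrow> nat"
  assumes finite_V: "finite V" and root_in_V: "r \<in> V"
    and parent_in_V: "\<And>u. u \<in> V \<Longrightarrow> u \<noteq> r \<Longrightarrow> p u \<in> V"
    and rank_parent: "\<And>u. u \<in> V \<Longrightarrow> u \<noteq> r \<Longrightarrow> rank (p u) < rank u"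
begin

lemma pair_graph_parent_graph: "pair_graph (parent_graph V r p)"
proof
  fix e
  assume e: "e \<in> parcs (parent_graph V r p)"
  show "fst e \<in> pverts (parent_graph V r p)" "snd e \<in> pverts (parent_graph V r p)"
    using e by (auto simp: parent_graph_def intro: parent_in_V)
  show "fst e \<noteq> snd e"
    using e rank_parent by (force simp: parent_graph_def)
next
  show "finite (pverts (parent_graph V r p))" "finite (parcs (parent_graph V r p))"
    using finite_V by (auto simp: parent_graph_def)
  show "symmetric (with_proj (parent_graph V r p))"
    by (auto simp: symmetric_def sym_def parcs_parent_graph)
qed

sublocale pair_graph "parent_graph V r p"
  by (rule pair_graph_parent_graph)

lemma connected_parent_graph: "Digraph_Component.connected (with_proj (parent_graph V r p))"
proof -
  let ?R = "rtrancl_on V ((parcs (parent_graph V r p))\<^sup>s)"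
  have *: "(u, r) \<in> ?R" if "u \<in> V" for u
    using that
  proof (induction "rank u" arbitrary: u rule: less_induct)
    case less
    show ?case
    proof (cases "u = r")
      case False
      then have "(p u, r) \<in> ?R" "(u, p u) \<in> parcs (parent_graph V r p)"
        using less parent_in_V rank_parent by (auto simp: parcs_parent_graph)
      then show ?thesis
        using less.prems parent_in_V[of u] False
        by (intro converse_rtrancl_on_into_rtrancl_on[of u "p u"]) (auto simp: symcl_def)
    qed (simp add: root_in_V)
  qed
  have "sym ?R"
    by (intro rtrancl_on_sym) (auto simp: sym_def symcl_def)
  with * have "(r, u) \<in> ?R" if "u \<in> V" for u
    using that by (meson symE)
  with * show ?thesis
    using root_in_V by (auto simp: connected_conv intro: rtrancl_on_trans)
qed

text \<open>Each arc joins a vertex and its parent, so a two-sided bound on these pairs covers both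
  directions.\<close>

lemma potential_arcI:
  fixes \<phi> :: "'a \<Rightarrow> real"
  assumes "\<And>u. u \<in> V \<Longrightarrow> u \<noteq> r \<Longrightarrow> \<bar>\<phi> u - \<phi> (p u)\<bar> \<le> 1"
    and "(u, v) \<in> parcs (parent_graph V r p)"
  shows "\<phi> v \<le> \<phi> u + 1"
  using assms(1)[of u] assms(1)[of v] assms(2) by (auto simp: parcs_parent_graph)

lemma vdist_parent_le:
  assumes "u \<in> V" "u \<noteq> r" "vdist (parent_graph V r p) (p u) w \<le> ereal d"
  shows "vdist (parent_graph V r p) u w \<le> ereal (1 + d)"
  using assms by (intro vdist_arc_le[of u "p u"]) (auto simp: parcs_parent_graph)

lemma out_degree_parent_graph:
  "out_degree (with_proj (parent_graph V r p)) u = card {v. (u, v) \<in> parcs (parent_graph V r p)}"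
proof -
  have "out_arcs (with_proj (parent_graph V r p)) u =
      Pair u ` {v. (u, v) \<in> parcs (parent_graph V r p)}"
    by (auto simp: out_arcs_def)
  then show ?thesis
    by (simp add: out_degree_def card_image inj_on_def)
qed

lemma max_degree_parent_graph:
  assumes "u \<in> V" "card {v. (u, v) \<in> parcs (parent_graph V r p)} = d"
    and "\<And>u. u \<in> V \<Longrightarrow> card {v. (u, v) \<in> parcs (parent_graph V r p)} \<le> d"
  shows "max_degree (parent_graph V r p) = d"
  unfolding max_degree_def out_degree_parent_graph
  using assms finite_V by (intro Max_eqI) auto

end

section \<open>Paths\<close>

definition path_graph :: "nat \<Rightarrow> nat pair_pre_digraph" where
  "path_graph n = parent_graph {..<n} 0 (\<lambda>i. i - 1)"

lemma rooted_tree_path: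
  assumes "0 < n"
  shows "rooted_tree {..<n} 0 (\<lambda>i. i - 1) id"
  using assms by unfold_locales auto

lemma max_degree_path_graph:
  assumes "2 \<le> n"
  shows "max_degree (path_graph n) = min 2 (n - 1)"
proof -
  interpret rooted_tree "{..<n}" 0 "\<lambda>i. i - 1" id
    using assms by (intro rooted_tree_path) auto
  have nbrs: "{v. (u, v) \<in> parcs (parent_graph {..<n} 0 (\<lambda>i. i - 1))} =
      (if u = 0 then {} else {u - 1}) \<union> (if u + 1 < n then {u + 1} else {})" if "u < n" for u
    using that by (auto simp: parcs_parent_graph)
  show ?thesis
    unfolding path_graph_def
  \<comment> \<open>Vertex 1 attains the maximum: it is an end if \<open>n = 2\<close> and an inner
    vertex otherwise.\<close>
  proof (rule max_degree_parent_graph[of 1])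
    show "1 \<in> {..<n}" using assms by simp
    show "card {v. (1, v) \<in> parcs (parent_graph {..<n} 0 (\<lambda>i. i - 1))} = min 2 (n - 1)"
      using assms by (subst nbrs) (auto simp: card_insert_if)
    fix u
    assume "u \<in> {..<n}"
    then show "card {v. (u, v) \<in> parcs (parent_graph {..<n} 0 (\<lambda>i. i - 1))} \<le> min 2 (n - 1)"
      using assms by (subst nbrs) (auto simp: card_insert_if)
  qed
qed

text \<open>Any play fills the board, and the first player owns at least the \<open>t\<close>
  vertices he claimed.\<close>

lemma value_A_all_claimed:
  assumes "pair_graph G" "card (pverts G) = 2 * t"
  shows "real t \<le> value_A G t {} {}"
proof -
  interpret pair_graph G by fact
  define ok where "ok A B \<longleftrightarrow> A \<subseteq> pverts G \<and> B \<subseteq> pverts G \<and> A \<inter> B = {}" for A B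
  have fins: "finite A" "finite B" "card (A \<union> B) = card A + card B" if "ok A B" for A B
    using that by (auto simp: ok_def card_Un_disjoint finite_subset)
  have full: "card A + card B = 2 * t" if "ok A B" "pverts G \<subseteq> A \<union> B" for A B
    using fins[OF that(1)] that assms(2) by (metis ok_def Un_least subset_antisym)
  show ?thesis
  proof (rule value_ge_invariant(1)[of _ "\<lambda>k A B. ok A B \<and> card A + k = t \<and> card B + k = t" _
        "\<lambda>k A B. ok A B \<and> card A + k = t \<and> card B + k + 1 = t"])
    fix k A B
    assume I: "ok A B \<and> card A + k = t \<and> card B + k = t" and "k = 0 \<or> pverts G \<subseteq> A \<union> B"
    then have "card A = t"
      using full[of A B] by auto
    moreover have "real (card A) \<le> voronoi_score G A B"
      using I by (intro voronoi_score_ge_card vsetdist_claimed_less) (auto simp: ok_def)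
    ultimately show "real t \<le> voronoi_score G A B" by simp
  next
    fix k A B
    \<comment> \<open>Impossible by parity: on the second player's turn an odd number of vertices is
      claimed.\<close>
    assume "ok A B \<and> card A + k = t \<and> card B + k + 1 = t" "pverts G \<subseteq> A \<union> B"
    then show "real t \<le> voronoi_score G A B"
      using full[of A B] by auto
  next
    fix k A B
    assume I: "ok A B \<and> card A + Suc k = t \<and> card B + Suc k = t" "\<not> pverts G \<subseteq> A \<union> B"
    then obtain v where "v \<in> pverts G - (A \<union> B)" by blast
    moreover have "ok (insert v A) B \<and> card (insert v A) + k = t \<and> card B + k + 1 = t"
      using I fins(1)[of A B] calculation by (auto simp: ok_def)
    ultimately show "\<exists>v\<in>pverts G - (A \<union> B).
        ok (insert v A) B \<and> card (insert v A) + k = t \<and> card B + k + 1 = t" by blast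
  next
    fix k A B v
    assume "ok A B \<and> card A + k = t \<and> card B + k + 1 = t" "v \<in> pverts G - (A \<union> B)"
    then show "ok A (insert v B) \<and> card A + k = t \<and> card (insert v B) + k = t"
      using fins(2)[of A B] by (auto simp: ok_def)
  qed (auto simp: ok_def)
qed

text \<open>For \<open>t = 1\<close> a path with \<open>2 * t\<close> vertices has maximum degree 1,
  so three vertices are taken. The first player claims the middle; after the reply \<open>b\<close>
  at one end, the other end \<open>2 - b\<close> is his as well.\<close>

lemma value_A_path_3: "2 \<le> value_A (path_graph 3) 1 {} {}"
proof -
  interpret rooted_tree "{..<3}" 0 "\<lambda>i. i - 1 :: nat" id
    by (rule rooted_tree_path) simp
  let ?G = "parent_graph {..<3} 0 (\<lambda>i. i - 1 :: nat)"
  have "2 \<le> value_B ?G 0 {1} {}"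
  proof (rule value_B_ge)
    assume "pverts ?G \<subseteq> {1} \<union> {}"
    then have "0 \<in> {1 :: nat}" by (force simp: subset_iff)
    then show "2 \<le> voronoi_score ?G {1} {}" by simp
  next
    fix b
    assume "b \<in> pverts ?G - ({1} \<union> {})"
    then have b: "b = 0 \<or> b = 2" by auto
    have "vsetdist ?G (2 - b) {1} < vsetdist ?G (2 - b) {b}"
    proof (rule vsetdist_less)
      have "vdist ?G 1 1 \<le> ereal 0"
        using vdist_self_le[of 1] by (simp add: zero_ereal_def)
      then show "vdist ?G (2 - b) 1 \<le> ereal (1 + 0)"
        using b by (intro vdist_arc_le[of "2 - b" 1]) (auto simp: parcs_parent_graph)
      \<comment> \<open>The potential is the distance to \<open>2 - b\<close> along the
        path.\<close>
      show "\<bar>real (2 - b) - real (2 - b)\<bar> + (1 + 0) + 1 \<le> \<bar>real c - real (2 - b)\<bar>"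
        if "c \<in> {b}" for c
        using that b by auto
    qed (use b in \<open>auto simp: parcs_parent_graph\<close>)
    moreover have "vsetdist ?G 1 {1} < vsetdist ?G 1 {b}"
      using b by (intro vsetdist_claimed_less) auto
    ultimately have "real (card {1, 2 - b}) \<le> voronoi_score ?G {1} {b}"
      using b by (intro voronoi_score_ge_card) auto
    moreover have "card {1, 2 - b} = 2"
      using b by (auto simp: card_insert_if)
    ultimately show "2 \<le> value_A ?G 0 {1} (insert b {})" by simp
  qed simp
  also have "\<dots> \<le> value_A ?G (Suc 0) {} {}"
    by (intro value_B_le_value_A) auto
  finally show ?thesis by (simp add: path_graph_def)
qed

section \<open>Hub with rays carrying pendant paths\<close>

text \<open>
  \<open>enc j x h\<close> is the vertex at distance \<open>x\<close> from the hub along ray \<open>j\<close> if \<open>h = 0\<close>, and the \<open>h\<close>-th vertex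
  of the pendant path attached there if \<open>h > 0\<close>.
\<close>

definition enc :: "nat \<Rightarrow> nat \<Rightarrow> nat \<Rightarrow> nat" where
  "enc j x h = prod_encode (j, prod_encode (x, h))"

definition ray :: "nat \<Rightarrow> nat" where
  "ray v = fst (prod_decode v)"

definition pos :: "nat \<Rightarrow> nat" where
  "pos v = fst (prod_decode (snd (prod_decode v)))"

definition dep :: "nat \<Rightarrow> nat" where
  "dep v = snd (prod_decode (snd (prod_decode v)))"

lemma enc_simps [simp]:
  "ray (enc j x h) = j" "pos (enc j x h) = x" "dep (enc j x h) = h" "enc (ray v) (pos v) (dep v) = v"
  by (simp_all add: enc_def ray_def pos_def dep_def)

lemma enc_eq_iff [simp]: "enc j x h = enc j' x' h' \<longleftrightarrow> j = j' \<and> x = x' \<and> h = h'"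
  by (simp add: enc_def)

abbreviation hub :: nat where
  "hub \<equiv> enc 0 0 0"

text \<open>All rays share the hub, so position 0 has to be the same vertex for every
  \<open>j\<close>.\<close>

definition spine :: "nat \<Rightarrow> nat \<Rightarrow> nat" where
  "spine j x = (if x = 0 then hub else enc j x 0)"

lemma spine_0 [simp]: "spine j 0 = hub"
  by (simp add: spine_def)

lemma pos_spine [simp]: "pos (spine j x) = x"
  by (simp add: spine_def)

lemma dep_spine [simp]: "dep (spine j x) = 0"
  by (simp add: spine_def)

locale comb =
  fixes \<Delta> t m N :: nat
  assumes degree_ge_3: "3 \<le> \<Delta>"
begin

text \<open>The factor \<open>t + 1\<close> puts all attachment points further than \<open>t\<close>
  from the hub; the ratio 3 separates the windows below.\<close>

definition root_pos :: "nat \<Rightarrow> nat" where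
  "root_pos i = (t + 1) * 3 ^ i"

text \<open>The length of the rays is independent of \<open>N\<close>, so \<open>N\<close> can be
  chosen large compared with it.\<close>

definition len :: nat where
  "len = root_pos m"

definition V :: "nat set" where
  "V = insert hub {v. ray v < \<Delta> \<and> pos v \<in> {1..len} \<and>
         (dep v = 0 \<or> dep v \<le> N \<and> pos v \<in> root_pos ` {..<m})}"

definition parent :: "nat \<Rightarrow> nat" where
  "parent v = (if 0 < dep v then enc (ray v) (pos v) (dep v - 1) else spine (ray v) (pos v - 1))"

abbreviation G :: "nat pair_pre_digraph" where
  "G \<equiv> parent_graph V hub parent"

lemma root_pos_gt: "t < root_pos i"
  using mult_le_mono2[of 1 "3 ^ i" "t + 1"] by (simp add: root_pos_def)

lemma root_pos_mono: "i \<le> k \<Longrightarrow> root_pos i \<le> root_pos k"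
  unfolding root_pos_def by (intro mult_left_mono power_increasing) auto

lemma root_pos_Suc: "root_pos (Suc i) = 3 * root_pos i"
  by (simp add: root_pos_def)

lemma root_pos_le_len: "i \<le> m \<Longrightarrow> root_pos i \<le> len"
  unfolding len_def by (rule root_pos_mono)

lemma inj_root_pos: "inj root_pos"
  by (simp add: inj_on_def root_pos_def del: mult_Suc)

section \<open>Vertices of the comb and their number\<close>

lemma enc_in_V:
  "enc j x h \<in> V \<longleftrightarrow> j = 0 \<and> x = 0 \<and> h = 0 \<or>
     j < \<Delta> \<and> x \<in> {1..len} \<and> (h = 0 \<or> h \<le> N \<and> x \<in> root_pos ` {..<m})"
  by (auto simp: V_def)

lemma spine_in_V: "j < \<Delta> \<Longrightarrow> x \<le> len \<Longrightarrow> spine j x \<in> V"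
  by (auto simp: spine_def enc_in_V)

lemma V_subset:
  "V \<subseteq> insert hub ((\<lambda>(j, x). enc j x 0) ` ({..<\<Delta>} \<times> {1..len}) \<union>
     (\<lambda>(j, i, h). enc j (root_pos i) h) ` ({..<\<Delta>} \<times> {..<m} \<times> {1..N}))"
proof
  fix v
  assume "v \<in> V"
  then consider "v = hub" | "ray v < \<Delta>" "pos v \<in> {1..len}" "dep v = 0"
    | i where "ray v < \<Delta>" "dep v \<in> {1..N}" "pos v = root_pos i" "i < m"
    unfolding V_def by force
  then show "v \<in> insert hub ((\<lambda>(j, x). enc j x 0) ` ({..<\<Delta>} \<times> {1..len}) \<union>
     (\<lambda>(j, i, h). enc j (root_pos i) h) ` ({..<\<Delta>} \<times> {..<m} \<times> {1..N}))"
  proof cases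
    case 1
    then show ?thesis by simp
  next
    case 2
    then have "v = (\<lambda>(j, x). enc j x 0) (ray v, pos v)"
      by (metis case_prod_conv enc_simps(4))
    with 2 show ?thesis by blast
  next
    case 3
    then have "v = (\<lambda>(j, i, h). enc j (root_pos i) h) (ray v, i, dep v)"
      by (metis case_prod_conv enc_simps(4))
    with 3 show ?thesis by blast
  qed
qed

lemma finite_V: "finite V"
  by (rule finite_subset[OF V_subset]) auto

lemma card_V_le: "card V \<le> 1 + \<Delta> * len + \<Delta> * m * N"
proof -
  have "card V \<le> card (insert hub ((\<lambda>(j, x). enc j x 0) ` ({..<\<Delta>} \<times> {1..len}) \<union>
     (\<lambda>(j, i, h). enc j (root_pos i) h) ` ({..<\<Delta>} \<times> {..<m} \<times> {1..N})))"
    by (intro card_mono V_subset) auto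
  also have "\<dots> \<le> 1 + (card ((\<lambda>(j, x). enc j x 0) ` ({..<\<Delta>} \<times> {1..len})) +
     card ((\<lambda>(j, i, h). enc j (root_pos i) h) ` ({..<\<Delta>} \<times> {..<m} \<times> {1..N})))"
    by (intro order_trans[OF card_insert_le_m1[of "Suc _"]]) (auto intro: card_Un_le)
  also have "\<dots> \<le> 1 + (card ({..<\<Delta>} \<times> {1..len}) + card ({..<\<Delta>} \<times> {..<m} \<times> {1..N}))"
    by (intro add_left_mono add_mono card_image_le) auto
  also have "\<dots> = 1 + \<Delta> * len + \<Delta> * m * N"
    by (simp add: card_cartesian_product)
  finally show ?thesis .
qed

lemma card_V_ge: "2 * t \<le> card V"
proof -
  have "(\<lambda>(j, x). enc j x 0) ` ({..<\<Delta>} \<times> {1..len}) \<subseteq> V"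
    by (auto simp: enc_in_V)
  then have "card ((\<lambda>(j, x). enc j x 0) ` ({..<\<Delta>} \<times> {1..len})) \<le> card V"
    by (rule card_mono[OF finite_V])
  then have "\<Delta> * len \<le> card V"
    by (subst (asm) card_image) (auto simp: inj_on_def card_cartesian_product)
  moreover have "2 * t \<le> \<Delta> * len"
    using degree_ge_3 root_pos_gt[of m] by (intro mult_mono) (auto simp: len_def)
  ultimately show ?thesis by simp
qed

section \<open>Tree structure and maximum degree\<close>

sublocale rooted_tree V hub parent "\<lambda>v. pos v + dep v"
proof
  show "finite V" by (rule finite_V)
  show "hub \<in> V" by (simp add: enc_in_V)
  fix u
  assume u: "u \<in> V" "u \<noteq> hub"
  then show "parent u \<in> V"
    by (auto simp: parent_def V_def spine_def)
  show "pos (parent u) + dep (parent u) < pos u + dep u"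
    using u by (auto simp: parent_def V_def)
qed

text \<open>The hub has one neighbour per ray. Any other vertex has at most three: its parent, the
  next vertex of the ray and the next vertex of the pendant path.\<close>

lemma max_degree_comb: "max_degree G = \<Delta>"
proof (rule max_degree_parent_graph)
  show "hub \<in> V" by (rule root_in_V)
  have "{v. (hub, v) \<in> parcs G} = (\<lambda>j. enc j 1 0) ` {..<\<Delta>}" (is "?N = _")
  proof (intro equalityI subsetI)
    fix v
    assume "v \<in> ?N"
    then have v: "v \<in> V" "v \<noteq> hub" "parent v = hub"
      by (auto simp: parcs_parent_graph)
    then have "pos (parent v) = 0" "pos v \<ge> 1" "ray v < \<Delta>"
      by (auto simp: V_def)
    then have "dep v = 0" "pos v = 1"
      by (auto simp: parent_def split: if_splits)
    then have "v = enc (ray v) 1 0"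
      by (metis enc_simps(4))
    with \<open>ray v < \<Delta>\<close> show "v \<in> (\<lambda>j. enc j 1 0) ` {..<\<Delta>}" by blast
  next
    fix v
    assume "v \<in> (\<lambda>j. enc j 1 0) ` {..<\<Delta>}"
    moreover have "1 \<le> len"
      using root_pos_gt[of m] by (simp add: len_def)
    ultimately show "v \<in> ?N"
      by (auto simp: parcs_parent_graph enc_in_V parent_def)
  qed
  then show hub: "card {v. (hub, v) \<in> parcs G} = \<Delta>"
    by (simp add: card_image inj_on_def)
  fix u
  assume "u \<in> V"
  show "card {v. (u, v) \<in> parcs G} \<le> \<Delta>"
  proof (cases "u = hub")
    case False
    have "v = enc (ray u) (pos u + 1) 0 \<or> v = enc (ray u) (pos u) (dep u + 1)"
      if "v \<in> V" "v \<noteq> hub" "u = parent v" for v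
    proof (cases "0 < dep v")
      case True
      then show ?thesis
        using that by (auto simp: parent_def)
    next
      case dep: False
      then have "u = enc (ray v) (pos v - 1) 0" "pos v \<noteq> 0"
        using that False by (auto simp: parent_def spine_def V_def split: if_splits)
      then show ?thesis
        using dep by simp (metis enc_simps(4))
    qed
    then have "{v. (u, v) \<in> parcs G} \<subseteq>
        set [parent u, enc (ray u) (pos u + 1) 0, enc (ray u) (pos u) (dep u + 1)]"
      by (auto simp: parcs_parent_graph)
    from card_mono[OF _ this] have "card {v. (u, v) \<in> parcs G} \<le>
        card (set [parent u, enc (ray u) (pos u + 1) 0, enc (ray u) (pos u) (dep u + 1)])"
      by simp
    also have "\<dots> \<le> 3"
      by (rule order_trans[OF card_length]) simp
    finally show ?thesis using degree_ge_3 by simp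
  qed (use hub in simp)
qed

section \<open>Walks towards the hub\<close>

lemma vdist_spine_le:
  assumes "j < \<Delta>" "a \<le> x" "x \<le> len"
  shows "vdist G (spine j x) (spine j a) \<le> ereal (real x - real a)"
  using assms(2,3)
proof (induction x rule: dec_induct)
  case base
  then show ?case
    using vdist_self_le[of "spine j a"] spine_in_V[OF assms(1)] by (simp add: zero_ereal_def)
next
  case (step x)
  have "spine j (Suc x) \<in> V" "spine j (Suc x) \<noteq> hub" "parent (spine j (Suc x)) = spine j x"
    using step.prems assms(1) by (auto simp: spine_in_V) (auto simp: spine_def parent_def)
  then have "vdist G (spine j (Suc x)) (spine j a) \<le> ereal (1 + (real x - real a))"
    using step by (intro vdist_parent_le) auto
  then show ?case by (simp add: algebra_simps)
qed

lemma vdist_pendant_le: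
  assumes "j < \<Delta>" "i < m" "h \<le> N" "a \<le> root_pos i"
  shows "vdist G (enc j (root_pos i) h) (spine j a) \<le> ereal (real h + real (root_pos i) - real a)"
  using assms(3)
proof (induction h)
  case 0
  then show ?case
    using vdist_spine_le[OF assms(1,4)] root_pos_le_len[of i] root_pos_gt[of i] assms(2)
    by (simp add: spine_def)
next
  case (Suc h)
  have "enc j (root_pos i) (Suc h) \<in> V"
    using Suc.prems assms root_pos_le_len[of i] root_pos_gt[of i] by (auto simp: enc_in_V)
  moreover have "parent (enc j (root_pos i) (Suc h)) = enc j (root_pos i) h"
    by (simp add: parent_def)
  ultimately have "vdist G (enc j (root_pos i) (Suc h)) (spine j a)
      \<le> ereal (1 + (real h + real (root_pos i) - real a))"
    using Suc by (intro vdist_parent_le) auto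
  then show ?case by (simp add: algebra_simps)
qed

section \<open>Answered claims and the pendant paths won\<close>

text \<open>The interval has \<open>t + 1\<close> positions, more than the second player can block
  in \<open>t\<close> rounds. Claims with \<open>pos b + t > len\<close> count as answered at once:
  they lie beyond twice every attachment point, so the hub is closer to all pendant paths of the
  ray.\<close>

definition answered :: "nat set \<Rightarrow> nat \<Rightarrow> bool" where
  "answered A b \<longleftrightarrow> (pos b + t \<le> len \<longrightarrow> (\<exists>x\<in>{pos b..pos b + t}. spine (ray b) x \<in> A))"

text \<open>A claim on a ray at a position outside \<open>window i\<close> cannot win the \<open>i\<close>-th pendant path once answered.\<close>

definition window :: "nat \<Rightarrow> nat set" where
  "window i = {root_pos i - t..2 * root_pos i}"

text \<open>For \<open>i < k\<close>, window \<open>k\<close> starts at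
  \<open>3 * root_pos i - t\<close> or later, which exceeds \<open>2 * root_pos i\<close>. Hence a
  claim spoils at most one pendant path.\<close>

lemma window_disjoint:
  assumes "x \<in> window i" "x \<in> window k"
  shows "i = k"
proof -
  have "False" if "i < k" "x \<in> window i" "x \<in> window k" for i k
  proof -
    have "3 * root_pos i \<le> root_pos k"
      using root_pos_mono[of "Suc i" k] that(1) by (simp add: root_pos_Suc)
    then show False
      using that root_pos_gt[of i] by (auto simp: window_def)
  qed
  then show ?thesis
    using assms by (metis linorder_neqE_nat)
qed

text \<open>Let \<open>spine j a\<close> be the outermost vertex of the first player up to the
  attachment point. A claim more than \<open>t\<close> before the attachment point has its answer
  also before it, so the claim is cut off by \<open>spine j a\<close>, as are claims on other rays.
  A claim beyond twice the attachment point is further away than even the hub.\<close>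

lemma pendant_won:
  assumes "hub \<in> A" "A \<inter> B = {}" "B \<subseteq> V" "j < \<Delta>" "i < m" "h \<in> {1..N}"
    and window: "\<And>b. b \<in> B \<Longrightarrow> ray b = j \<Longrightarrow> pos b \<notin> window i"
    and answered: "\<And>b. b \<in> B \<Longrightarrow> ray b = j \<Longrightarrow> answered A b"
  shows "vsetdist G (enc j (root_pos i) h) A < vsetdist G (enc j (root_pos i) h) B"
proof -
  let ?X = "root_pos i"
  define a where "a = Max {x. x \<le> ?X \<and> spine j x \<in> A}"
  have "0 \<in> {x. x \<le> ?X \<and> spine j x \<in> A}"
    using assms(1) by simp
  then have "a \<in> {x. x \<le> ?X \<and> spine j x \<in> A}"
    unfolding a_def by (intro Max_in) auto
  then have a: "a \<le> ?X" "spine j a \<in> A"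
    by auto
  have a_max: "x \<le> a" if "x \<le> ?X" "spine j x \<in> A" for x
    unfolding a_def using that by (intro Max_ge) auto
  define d where "d = real h + real ?X - real a"
  \<comment> \<open>a lower bound for the distance from the given vertex, cut off behind \<open>spine j a\<close>\<close>
  define \<phi> where "\<phi> u =
      (if u = spine j a then d
       else if ray u = j \<and> (a < pos u \<or> pos u = ?X \<and> 0 < dep u)
       then real h + \<bar>real (pos u) - real ?X\<bar> - (if pos u = ?X then real (dep u) else 0)
       else d + 1)" for u
  have arc: "\<bar>\<phi> u - \<phi> (parent u)\<bar> \<le> 1" if "u \<in> V" "u \<noteq> hub" for u
  proof -
    obtain J x k where u: "u = enc J x k"
      by (metis enc_simps(4))
    have "1 \<le> x"
      using \<open>u \<in> V\<close> \<open>u \<noteq> hub\<close> by (auto simp: u V_def)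
    have spine: "\<phi> (spine J x) =
        (if J = j \<or> x = 0 then if x = a then d else if a < x then real h + \<bar>real x - real ?X\<bar> else d + 1
         else d + 1)" for x
      by (auto simp: \<phi>_def spine_def)
    have pendant: "\<phi> (enc J x (Suc k)) =
        (if J = j \<and> (a < x \<or> x = ?X)
         then real h + \<bar>real x - real ?X\<bar> - (if x = ?X then real (Suc k) else 0) else d + 1)" for k
      by (auto simp: \<phi>_def spine_def)
    \<comment> \<open>The three kinds of edges: along a ray, from a ray into a pendant path, and
      within a pendant path.\<close>
    consider "k = 0" | "k = 1" | k' where "k = Suc (Suc k')"
      by (metis One_nat_def not0_implies_Suc)
    then show ?thesis
    proof cases
      case 1
      then have "u = spine J x" "parent u = spine J (x - 1)"
        using \<open>1 \<le> x\<close> by (auto simp: u spine_def parent_def)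
      with spine[of x] spine[of "x - 1"] \<open>1 \<le> x\<close> a(1) show ?thesis
        by (auto simp: d_def of_nat_diff abs_if split: if_splits)
    next
      case 2
      then have "u = enc J x (Suc 0)" "parent u = spine J x"
        using \<open>1 \<le> x\<close> by (auto simp: u spine_def parent_def)
      with spine[of x] pendant[of 0] \<open>1 \<le> x\<close> a(1) show ?thesis
        by (auto simp: d_def)
    next
      case 3
      then have "u = enc J x (Suc (Suc k'))" "parent u = enc J x (Suc k')"
        by (auto simp: u parent_def)
      with pendant[of k'] pendant[of "Suc k'"] show ?thesis
        by auto
    qed
  qed
  have far: "\<phi> b \<ge> d + 1" if "b \<in> B" for b
  proof (cases "ray b = j \<and> (a < pos b \<or> pos b = ?X \<and> 0 < dep b)")
    case True
    then have b: "ray b = j" "pos b \<notin> window i"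
      using window[OF that] by auto
    with True have "a < pos b"
      by (auto simp: window_def)
    have "2 * ?X < pos b"
    \<comment> \<open>Otherwise the answer to \<open>b\<close> lies before the attachment point, and
      the maximality of \<open>a\<close> puts it, and thus \<open>b\<close>, at position at most
      \<open>a\<close>.\<close>
    proof (rule ccontr)
      assume "\<not> 2 * ?X < pos b"
      with b(2) have "pos b + t < ?X"
        by (auto simp: window_def)
      moreover from this have "pos b + t \<le> len"
        using root_pos_le_len[of i] assms(5) by simp
      ultimately obtain x where "x \<in> {pos b..pos b + t}" "spine j x \<in> A"
        using answered[OF \<open>b \<in> B\<close> b(1)] b(1) by (auto simp: answered_def)
      with a_max[of x] \<open>pos b + t < ?X\<close> \<open>a < pos b\<close> show False by simp
    qed
    moreover have "b \<noteq> spine j a"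
      using \<open>a < pos b\<close> by auto
    \<comment> \<open>Here \<open>\<phi> b\<close> is at least \<open>h + ?X + 1\<close>, while
      \<open>d\<close> is at most \<open>h + ?X\<close>.\<close>
    ultimately show ?thesis
      using True by (auto simp: \<phi>_def d_def)
  next
    case False
    moreover have "b \<noteq> spine j a"
      using that a(2) assms(2) by auto
    ultimately show ?thesis by (auto simp: \<phi>_def)
  qed
  have "\<phi> (enc j ?X h) = 0"
    using assms(6) by (auto simp: \<phi>_def spine_def)
  then show ?thesis
    using a(2) vdist_pendant_le[OF assms(4,5) _ a(1), of h] assms(6) far
    by (intro vsetdist_less[where \<phi> = \<phi> and d = d] potential_arcI[where \<phi> = \<phi>, OF arc]) (auto simp: d_def)
qed

text \<open>Discard the pendant paths on the ray of the possibly unanswered \<open>b\<^sub>0\<close>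
  and, for each claim, the at most one path whose window it hits. Every remaining path is won with
  all its \<open>N\<close> vertices.\<close>

lemma score_ge:
  assumes "hub \<in> A" "A \<inter> B = {}" "B \<subseteq> V" "card B \<le> t"
    and answered: "\<And>b. b \<in> B \<Longrightarrow> b \<noteq> b\<^sub>0 \<Longrightarrow> answered A b"
  shows "real N * (real (\<Delta> - 1) * real m - real t) \<le> voronoi_score G A B"
proof -
  define all where "all = ({..<\<Delta>} - {ray b\<^sub>0}) \<times> {..<m}"
  define bad where "bad = (\<Union>b\<in>B. {(j, i). j = ray b \<and> pos b \<in> window i})"
  define S where "S = (\<lambda>((j, i), h). enc j (root_pos i) h) ` ((all - bad) \<times> {1..N})"
  have "finite B"
    using assms(3) finite_V by (rule finite_subset)
  have fin1: "finite {(j, i). j = ray b \<and> pos b \<in> window i} \<and>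
      card {(j, i). j = ray b \<and> pos b \<in> window i} \<le> 1" for b
  proof -
    have "\<exists>q. {(j, i). j = ray b \<and> pos b \<in> window i} \<subseteq> {q}"
    proof (cases "\<exists>i. pos b \<in> window i")
      case True
      then obtain i where "pos b \<in> window i" by blast
      then show ?thesis
        using window_disjoint[of "pos b"] by (intro exI[of _ "(ray b, i)"]) auto
    qed auto
    then show ?thesis
      by (metis card_mono finite.emptyI finite_insert finite_subset is_singletonI is_singleton_altdef)
  qed
  have "finite bad"
    using \<open>finite B\<close> fin1 by (simp add: bad_def)
  have "card bad \<le> (\<Sum>b\<in>B. card {(j, i). j = ray b \<and> pos b \<in> window i})"
    unfolding bad_def using \<open>finite B\<close> by (rule card_UN_le)
  also have "\<dots> \<le> (\<Sum>b\<in>B. 1)"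
    using fin1 by (intro sum_mono) blast
  finally have "card bad \<le> t"
    using assms(4) by simp
  have "\<Delta> - 1 \<le> card ({..<\<Delta>} - {ray b\<^sub>0})"
    using diff_card_le_card_Diff[of "{ray b\<^sub>0}" "{..<\<Delta>}"] by simp
  then have "(\<Delta> - 1) * m \<le> card all"
    by (simp add: all_def card_cartesian_product)
  moreover have "card all \<le> card (all - bad) + t"
    using diff_card_le_card_Diff[OF \<open>finite bad\<close>, of all] \<open>card bad \<le> t\<close> by simp
  ultimately have "(\<Delta> - 1) * m \<le> card (all - bad) + t"
    by simp
  then have "real (\<Delta> - 1) * real m - real t \<le> real (card (all - bad))"
    by (metis diff_le_eq of_nat_add of_nat_le_iff of_nat_mult)
  then have "real N * (real (\<Delta> - 1) * real m - real t) \<le> real N * real (card (all - bad))"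
    by (rule mult_left_mono) simp
  also have "\<dots> = real (card S)"
  proof -
    have "inj_on (\<lambda>((j, i), h). enc j (root_pos i) h) ((all - bad) \<times> {1..N})"
      using inj_root_pos by (auto simp: inj_on_def)
    then show ?thesis
      by (simp add: S_def card_image card_cartesian_product mult.commute)
  qed
  also have "\<dots> \<le> voronoi_score G A B"
  proof (rule voronoi_score_ge_card)
    show "finite (pverts G)"
      using finite_V by simp
    show "S \<subseteq> pverts G"
    proof
      fix v
      assume "v \<in> S"
      then obtain j i h where "v = enc j (root_pos i) h" "j < \<Delta>" "i < m" "h \<in> {1..N}"
        unfolding S_def all_def by clarify auto
      then show "v \<in> pverts G"
        using root_pos_le_len[of i] root_pos_gt[of i] by (auto simp: enc_in_V)
    qed
    fix v
    assume "v \<in> S"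
    then obtain j i h where v: "v = enc j (root_pos i) h" "(j, i) \<in> all" "(j, i) \<notin> bad" "h \<in> {1..N}"
      by (auto simp: S_def)
    show "vsetdist G v A < vsetdist G v B"
      unfolding v(1)
    proof (rule pendant_won)
      show "pos b \<notin> window i" if "b \<in> B" "ray b = j" for b
        using v(3) that by (auto simp: bad_def)
      show "answered A b" if "b \<in> B" "ray b = j" for b
        using v(2) that by (intro answered) (auto simp: all_def)
    qed (use assms v in \<open>auto simp: all_def\<close>)
  qed
  finally show ?thesis .
qed

section \<open>The answering strategy\<close>

text \<open>Since \<open>b\<^sub>0\<close> is unanswered, the \<open>t + 1\<close> candidate
  vertices lie on the ray and none is in \<open>A\<close>; by pigeonhole one of them is not in
  \<open>B\<close>.\<close>

lemma answer_exists:
  assumes "B \<subseteq> V" "A \<inter> B = {}" "card B \<le> t" "b\<^sub>0 \<in> B" "\<not> answered A b\<^sub>0" "hub \<in> A"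
  shows "\<exists>v \<in> V - (A \<union> B). answered (insert v A) b\<^sub>0"
proof -
  let ?R = "spine (ray b\<^sub>0) ` {pos b\<^sub>0..pos b\<^sub>0 + t}"
  have b0: "b\<^sub>0 \<in> V" "b\<^sub>0 \<noteq> hub"
    using assms by auto
  then have "ray b\<^sub>0 < \<Delta>" "1 \<le> pos b\<^sub>0"
    by (auto simp: V_def)
  have "inj_on (spine (ray b\<^sub>0)) {pos b\<^sub>0..pos b\<^sub>0 + t}"
    by (metis inj_onI pos_spine)
  then have "card ?R = t + 1"
    by (simp add: card_image)
  moreover have "finite B"
    using assms(1) finite_V by (rule finite_subset)
  ultimately have "\<not> ?R \<subseteq> B"
    using card_mono[of B ?R] assms(3) by auto
  then obtain x where x: "x \<in> {pos b\<^sub>0..pos b\<^sub>0 + t}" "spine (ray b\<^sub>0) x \<notin> B"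
    by (meson image_subsetI)
  have "pos b\<^sub>0 + t \<le> len" "spine (ray b\<^sub>0) x \<notin> A"
    using assms(5) x(1) by (auto simp: answered_def)
  moreover have "spine (ray b\<^sub>0) x \<in> V"
    using \<open>ray b\<^sub>0 < \<Delta>\<close> x(1) calculation by (intro spine_in_V) auto
  moreover have "answered (insert (spine (ray b\<^sub>0) x) A) b\<^sub>0"
    using x(1) by (auto simp: answered_def)
  ultimately show ?thesis
    using x(2) by blast
qed

lemma answered_insert: "answered A b \<Longrightarrow> answered (insert v A) b"
  by (auto simp: answered_def)

lemma value_ge:
  assumes "1 \<le> t"
  shows "real N * (real (\<Delta> - 1) * real m - real t) \<le> value_A G t {} {}" (is "?s \<le> _")
proof -
  define ok where "ok A B \<longleftrightarrow> hub \<in> A \<and> A \<inter> B = {} \<and> B \<subseteq> V" for A B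
  \<comment> \<open>At most one claim, in play the latest, is unanswered when the first player is to
    move (\<open>I\<close>); none is after his move (\<open>J\<close>). The bounds on
    \<open>card B + k\<close> ensure at most \<open>t\<close> claims. The opening move on the hub
    establishes \<open>J\<close>.\<close>
  define I where "I k A B \<longleftrightarrow> ok A B \<and> card B + k \<le> t \<and>
    (\<exists>b\<^sub>0. \<forall>b\<in>B. b \<noteq> b\<^sub>0 \<longrightarrow> answered A b)" for k A B
  define J where "J k A B \<longleftrightarrow> ok A B \<and> card B + k < t \<and> (\<forall>b\<in>B. answered A b)" for k A B
  have I: "?s \<le> voronoi_score G A B" if "I k A B" for k A B
    using that score_ge[of A B] by (auto simp: I_def ok_def)
  obtain k where k: "t = Suc k"
    using assms by (cases t) auto
  have "?s \<le> value_B G k {hub} {}"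
  proof (rule value_ge_invariant(2)[where I = I and J = J])
    show "?s \<le> voronoi_score G A B" if "J k A B" for k A B
      using that by (intro I[of k]) (auto simp: I_def J_def)
    show "\<exists>v\<in>pverts G - (A \<union> B). J k (insert v A) B"
      if IS: "I (Suc k) A B" and "\<not> pverts G \<subseteq> A \<union> B" for k A B
    proof -
      obtain b\<^sub>0 where b0: "\<And>b. b \<in> B \<Longrightarrow> b \<noteq> b\<^sub>0 \<Longrightarrow> answered A b"
        using IS by (auto simp: I_def)
      have "\<exists>v\<in>V - (A \<union> B). b\<^sub>0 \<in> B \<longrightarrow> answered (insert v A) b\<^sub>0"
      proof (cases "b\<^sub>0 \<in> B \<and> \<not> answered A b\<^sub>0")
        case True
        then show ?thesis
          using answer_exists[of B A b\<^sub>0] IS by (auto simp: I_def ok_def)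
      next
        \<comment> \<open>Nothing needs an answer, so any free vertex will do: further claims of the
          first player keep claims answered.\<close>
        case False
        then show ?thesis
          using that(2) answered_insert by auto
      qed
      then obtain v where v: "v \<in> V - (A \<union> B)" "b\<^sub>0 \<in> B \<longrightarrow> answered (insert v A) b\<^sub>0"
        by blast
      have "answered (insert v A) b" if "b \<in> B" for b
        using that v(2) b0[of b] answered_insert by (cases "b = b\<^sub>0") auto
      then have "J k (insert v A) B"
        using IS v(1) by (auto simp: I_def J_def ok_def)
      then show ?thesis using v(1) by auto
    qed
    show "I k A (insert v B)" if "J k A B" "v \<in> pverts G - (A \<union> B)" for k A B v
    proof -
      have "card (insert v B) \<le> card B + 1"
        by (simp add: card_insert_le_m1)
      then show ?thesis
        using that by (auto simp: I_def J_def ok_def intro: exI[of _ v])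
    qed
    show "J k {hub} {}"
      using k by (simp add: J_def ok_def)
  qed (use I finite_V in auto)
  also have "\<dots> \<le> value_A G (Suc k) {} {}"
    using root_in_V finite_V by (intro value_B_le_value_A) auto
  finally show ?thesis
    using k by simp
qed

end

section \<open>Choice of the graph and its parameters\<close>

theorem theorem5:
  fixes \<Delta> t :: nat and \<epsilon> :: real
  assumes "\<Delta> \<ge> 1" and "t \<ge> 1" and "\<epsilon> > 0"
  shows "\<exists>G :: nat pair_pre_digraph.
           pair_graph G \<and> Digraph_Component.connected (with_proj G) \<and> max_degree G = \<Delta> \<and>
           (\<Delta> \<ge> 2 \<longrightarrow> 2 * t \<le> card (pverts G)) \<and>
           voronoi_ratio G t \<ge> 1 - 1 / real \<Delta> - \<epsilon>"
proof -
  have path: "pair_graph (path_graph n)" "Digraph_Component.connected (with_proj (path_graph n))"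
    "card (pverts (path_graph n)) = n" if "n > 0" for n
  proof -
    interpret rooted_tree "{..<n}" 0 "\<lambda>i. i - 1" id
      using that by (rule rooted_tree_path)
    show "pair_graph (path_graph n)" "Digraph_Component.connected (with_proj (path_graph n))"
      "card (pverts (path_graph n)) = n"
      using pair_graph_parent_graph connected_parent_graph by (simp_all add: path_graph_def)
  qed
  consider "\<Delta> = 1" | "\<Delta> = 2" "t = 1" | "\<Delta> = 2" "t \<ge> 2" | "\<Delta> \<ge> 3"
    using assms by linarith
  then show ?thesis
  proof cases
    case 1
    \<comment> \<open>For \<open>\<Delta> = 1\<close> the bound is negative, so a single edge
      suffices.\<close>
    have "0 \<le> value_A (path_graph 2) t {} {}"
      by (rule value_A_nonneg) (simp add: path_graph_def)
    then show ?thesis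
      using 1 path[of 2] assms(3) max_degree_path_graph[of 2]
      by (intro exI[of _ "path_graph 2"]) (auto simp: voronoi_ratio_def)
  next
    case 2
    then show ?thesis
      using path[of 3] value_A_path_3 max_degree_path_graph[of 3] assms(3)
      by (intro exI[of _ "path_graph 3"]) (auto simp: voronoi_ratio_def)
  next
    case 3
    have "real t \<le> value_A (path_graph (2 * t)) t {} {}"
      using 3 path[of "2 * t"] by (intro value_A_all_claimed) auto
    then have "1 / 2 \<le> voronoi_ratio (path_graph (2 * t)) t"
      using 3 path(3)[of "2 * t"] by (simp add: voronoi_ratio_def field_simps)
    then show ?thesis
      using 3 path[of "2 * t"] max_degree_path_graph[of "2 * t"] assms(3)
      by (intro exI[of _ "path_graph (2 * t)"]) auto
  next
    case 4
    \<comment> \<open>So many pendant paths that the \<open>t\<close> spoiled ones, plus one more,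
      are at most a fraction \<open>\<epsilon>\<close> of \<open>1 + \<Delta> * m\<close>.\<close>
    define m where "m = nat \<lceil>(real t + 1) / \<epsilon>\<rceil>"
    \<comment> \<open>The hub and the rays together have at most \<open>N\<close> vertices, so they
      weigh no more than one additional pendant path.\<close>
    define N where "N = 1 + \<Delta> * comb.len t m"
    interpret comb \<Delta> t m N
      using 4 by unfold_locales
    have m: "real t + 1 \<le> \<epsilon> * (1 + real \<Delta> * real m)"
    proof -
      have "(real t + 1) / \<epsilon> \<le> real m"
        unfolding m_def by (rule real_nat_ceiling_ge)
      also have "\<dots> \<le> 1 + real \<Delta> * real m"
        using 4 mult_right_mono[of 1 "real \<Delta>" "real m"] by simp
      finally show ?thesis
        using assms(3) by (simp add: field_simps)
    qed
    have "card V \<le> N * (1 + \<Delta> * m)"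
      using card_V_le by (simp add: N_def algebra_simps)
    then have card: "real (card V) \<le> real N * (1 + real \<Delta> * real m)"
      by (metis of_nat_1 of_nat_add of_nat_le_iff of_nat_mult)
    have "(1 - 1 / real \<Delta> - \<epsilon>) * real (card V) \<le> value_A G t {} {}"
    \<comment> \<open>The upper bound on \<open>card V\<close> can be multiplied only by a
      nonnegative factor; a negative one makes the claim trivial.\<close>
    proof (cases "0 \<le> 1 - 1 / real \<Delta> - \<epsilon>")
      case True
      have "(1 - 1 / real \<Delta> - \<epsilon>) * (1 + real \<Delta> * real m) =
          real (\<Delta> - 1) * real m + (1 - 1 / real \<Delta>) - \<epsilon> * (1 + real \<Delta> * real m)"
        using 4 by (simp add: field_simps of_nat_diff)
      also have "\<dots> \<le> real (\<Delta> - 1) * real m - real t"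
      proof -
        have "1 - 1 / real \<Delta> \<le> 1" by simp
        with m show ?thesis by linarith
      qed
      finally have "(1 - 1 / real \<Delta> - \<epsilon>) * (1 + real \<Delta> * real m)
          \<le> real (\<Delta> - 1) * real m - real t" .
      then have "real N * ((1 - 1 / real \<Delta> - \<epsilon>) * (1 + real \<Delta> * real m))
          \<le> real N * (real (\<Delta> - 1) * real m - real t)"
        by (rule mult_left_mono) simp
      with mult_left_mono[OF card True] value_ge[OF assms(2)] show ?thesis
        by (simp only: mult.left_commute[of "real N"])
    next
      case False
      then have "(1 - 1 / real \<Delta> - \<epsilon>) * real (card V) \<le> 0"
        by (intro mult_nonpos_nonneg) auto
      also have "0 \<le> value_A G t {} {}"
        using finite_V by (intro value_A_nonneg) simp
      finally show ?thesis .
    qed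
    moreover have "0 < card V"
      using root_in_V finite_V card_gt_0_iff by blast
    ultimately have "1 - 1 / real \<Delta> - \<epsilon> \<le> voronoi_ratio G t"
      by (simp add: voronoi_ratio_def pos_le_divide_eq)
    then show ?thesis
      using pair_graph_parent_graph connected_parent_graph max_degree_comb card_V_ge by auto
  qed
qed

end
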